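(* The upper P-positions $\{(a_n,b_n)\mid n\in\mathbb{N}_0\}$ of $(1,2)$-GDWN split.
   Context: $\mathbb{N}$ denotes the positive integers and $\mathbb{N}_0$ the nonnegative integers. The game $(1,2)$-GDWN (Generalized Diagonal Wythoff Nim) is the impartial two-player game with positions $(x,y)\in\mathbb{N}_0\times\mathbb{N}_0$ where the options of $(x,y)$ are all pairs with nonnegative coordinates of the form $(x-t,y)$, $(x,y-t)$, $(x-t,y-t)$, $(x-t,y-2t)$, $(x-2t,y-t)$ with $t\in\mathbb{N}$. Normal play: a player who cannot move loses. A position is a P-position if none of its options is a P-position; otherwise it is an N-position. Upper P-positions: $(a_0,b_0)=(0,0)$, and $(a_n,b_n)$, $n\ge1$, lists all P-positions $(x,y)$ with $0<x<y$ in order of strictly increasing first coordinate. The complete set of P-positions is $\{(a_i,b_i),(b_i,a_i)\mid i\in\mathbb{N}\}\cup\{(0,0)\}$. Split: a sequence of pairs of natural numbers $(x_i,y_i)$ splits if there are real numbers $\alpha>0$ and $\epsilon>0$ such that $\{i>n\mid \alpha\le y_i/x_i\le\alpha+\epsilon\}$ is empty for all sufficiently large $n$, while both $\{(x_i,y_i)\mid y_i/x_i<\alpha\}$ and $\{(x_i,y_i)\mid y_i/x_i>\alpha+\epsilon\}$ are infinite. (For $(a_n,b_n)$ the ratios are considered for $n\ge1$.) *)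

theory Defs
  imports Complex_Main "HOL-Library.Infinite_Set"
begin

text \<open>Subtraction on \<^typ>\<open>nat\<close> truncates, so the side conditions are what enforces nonnegative
  coordinates.\<close>

definition gdwn_moves :: "nat \<times> nat \<Rightarrow> (nat \<times> nat) set" where
  "gdwn_moves p = (case p of (x, y) \<Rightarrow>
       {(x - t, y) | t. 0 < t \<and> t \<le> x}
     \<union> {(x, y - t) | t. 0 < t \<and> t \<le> y}
     \<union> {(x - t, y - t) | t. 0 < t \<and> t \<le> x \<and> t \<le> y}
     \<union> {(x - t, y - 2 * t) | t. 0 < t \<and> t \<le> x \<and> 2 * t \<le> y}
     \<union> {(x - 2 * t, y - t) | t. 0 < t \<and> 2 * t \<le> x \<and> t \<le> y})"

lemma gdwn_moves_less: "q \<in> gdwn_moves p \<Longrightarrow> fst q + snd q < fst p + snd p"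
  by (auto simp: gdwn_moves_def split: prod.splits)

function gdwn_P :: "nat \<times> nat \<Rightarrow> bool" where
  "gdwn_P p \<longleftrightarrow> (\<forall>q \<in> gdwn_moves p. \<not> gdwn_P q)"
  by auto
termination
  by (relation "measure (\<lambda>p. fst p + snd p)") (auto dest: gdwn_moves_less)

declare gdwn_P.simps [simp del]

definition gdwn_upper_set :: "(nat \<times> nat) set" where
  "gdwn_upper_set = {(x, y). gdwn_P (x, y) \<and> 0 < x \<and> x < y}"

text \<open>The function \<^const>\<open>enumerate\<close> lists an infinite set of natural numbers increasingly, starting
  at index 0. That the set of first coordinates is infinite, and that the first coordinate
  determines the second one, is shown below.\<close>

definition gdwn_a :: "nat \<Rightarrow> nat" where
  "gdwn_a n = (if n = 0 then 0 else enumerate (fst ` gdwn_upper_set) (n - 1))"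

definition gdwn_b :: "nat \<Rightarrow> nat" where
  "gdwn_b n = (if n = 0 then 0 else (THE y. (gdwn_a n, y) \<in> gdwn_upper_set))"

text \<open>Only indices \<open>i \<ge> 1\<close> count, which excludes the ratio \<open>0 / 0\<close> of the pair \<open>(0, 0)\<close>.\<close>

definition splits :: "(nat \<Rightarrow> nat) \<Rightarrow> (nat \<Rightarrow> nat) \<Rightarrow> bool" where
  "splits x y \<longleftrightarrow> (\<exists>\<alpha> \<epsilon> :: real. 0 < \<alpha> \<and> 0 < \<epsilon> \<and>
     (\<forall>\<^sub>F n in sequentially. {i. i > n \<and> \<alpha> \<le> real (y i) / real (x i) \<and>
        real (y i) / real (x i) \<le> \<alpha> + \<epsilon>} = {}) \<and>
     infinite {(x i, y i) | i. i \<ge> 1 \<and> real (y i) / real (x i) < \<alpha>} \<and>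
     infinite {(x i, y i) | i. i \<ge> 1 \<and> real (y i) / real (x i) > \<alpha> + \<epsilon>})"


text \<open>The remaining facts show that \<^const>\<open>gdwn_a\<close> and \<^const>\<open>gdwn_b\<close> are the intended sequences.\<close>

lemma gdwn_P_not_option: "gdwn_P p \<Longrightarrow> q \<in> gdwn_moves p \<Longrightarrow> \<not> gdwn_P q"
  using gdwn_P.simps by blast

lemma gdwn_moves_swap:
  "q \<in> gdwn_moves p \<Longrightarrow> prod.swap q \<in> gdwn_moves (prod.swap p)"
  by (cases p) (auto simp: gdwn_moves_def)

lemma gdwn_P_swap: "gdwn_P (prod.swap p) = gdwn_P p"
proof (induction p rule: measure_induct_rule [where f = "\<lambda>p. fst p + snd p"])
  case (less p)
  have opts: "gdwn_moves (prod.swap p) = prod.swap ` gdwn_moves p"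
    using gdwn_moves_swap [of _ p] gdwn_moves_swap [of _ "prod.swap p"]
    by (force simp: image_iff)
  have "gdwn_P (prod.swap p) \<longleftrightarrow> (\<forall>q \<in> gdwn_moves p. \<not> gdwn_P (prod.swap q))"
    by (subst gdwn_P.simps) (simp add: opts)
  also have "\<dots> \<longleftrightarrow> (\<forall>q \<in> gdwn_moves p. \<not> gdwn_P q)"
    using less gdwn_moves_less by auto
  also have "\<dots> \<longleftrightarrow> gdwn_P p"
    by (rule gdwn_P.simps [symmetric])
  finally show ?case .
qed

lemma gdwn_P_sym: "gdwn_P (y, x) = gdwn_P (x, y)"
  using gdwn_P_swap [of "(x, y)"] by simp

lemma gdwn_P_column_unique:
  assumes "gdwn_P (x, y)" "gdwn_P (x, y')"
  shows "y = y'"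
proof -
  have False if "gdwn_P (x, u)" "gdwn_P (x, v)" "u < v" for u v
  proof -
    have "(x, u) = (x, v - (v - u)) \<and> 0 < v - u \<and> v - u \<le> v" using that by auto
    then have "(x, u) \<in> gdwn_moves (x, v)" unfolding gdwn_moves_def by blast
    then show False using that gdwn_P_not_option by blast
  qed
  then show ?thesis using assms by (metis nat_neq_iff)
qed

lemma gdwn_P_column_exists: "\<exists>y. gdwn_P (x, y)"
proof (rule ccontr)
  assume none: "\<nexists>y. gdwn_P (x, y)"
  let ?Q = "{q. gdwn_P q \<and> fst q < x}"
  have "inj_on fst ?Q" by (auto simp: inj_on_def dest: gdwn_P_column_unique)
  moreover have "fst ` ?Q \<subseteq> {..<x}" by auto
  ultimately have finQ: "finite ?Q" by (meson finite_imageD finite_lessThan finite_subset)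
  define F where "F = (\<lambda>q :: nat \<times> nat. {..snd q + 2 * x})"
  have "y \<in> (\<Union>q \<in> ?Q. F q)" for y
  proof -
    obtain q where q: "q \<in> gdwn_moves (x, y)" "gdwn_P q"
      using none gdwn_P.simps by blast
    have "fst q < x \<or> fst q = x"
      using q(1) by (auto simp: gdwn_moves_def)
    then have "fst q < x" using none q(2) by (cases q) auto
    moreover from this have "y \<le> snd q + 2 * x"
      using q(1) by (auto simp: gdwn_moves_def)
    ultimately show ?thesis using q(2) by (cases q) (auto simp: F_def)
  qed
  then have "(UNIV :: nat set) = (\<Union>q \<in> ?Q. F q)" by blast
  moreover have "finite (\<Union>q \<in> ?Q. F q)" using finQ by (auto simp: F_def)
  ultimately show False using infinite_UNIV_nat by metis
qed

lemma gdwn_P_zero: "gdwn_P (0, 0)"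
  by (subst gdwn_P.simps) (auto simp: gdwn_moves_def)

lemma gdwn_P_axis: "gdwn_P (0, y) \<Longrightarrow> y = 0"
  using gdwn_P_zero gdwn_P_column_unique by blast

lemma gdwn_P_diagonal: "gdwn_P (x, x) \<Longrightarrow> x = 0"
proof (rule ccontr)
  assume "gdwn_P (x, x)" "x \<noteq> 0"
  then have "(0, 0) = (x - x, x - x) \<and> 0 < x \<and> x \<le> x \<and> x \<le> x" by auto
  then have "(0, 0) \<in> gdwn_moves (x, x)" unfolding gdwn_moves_def by blast
  then show False using \<open>gdwn_P (x, x)\<close> gdwn_P_zero gdwn_P_not_option by blast
qed

lemma gdwn_P_set_decomp:
  "{p. gdwn_P p} = {(0, 0)} \<union> gdwn_upper_set \<union> prod.swap ` gdwn_upper_set"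
proof -
  have "p \<in> {(0, 0)} \<union> gdwn_upper_set \<union> prod.swap ` gdwn_upper_set" if "gdwn_P p" for p
  proof (cases p)
    case (Pair x y)
    then have xy: "gdwn_P (x, y)" "gdwn_P (y, x)" using that gdwn_P_sym by auto
    consider "x = 0 \<or> y = 0 \<or> x = y" | "0 < x" "x < y" | "0 < y" "y < x" by linarith
    then show ?thesis
    proof cases
      case 1
      then have "p = (0, 0)"
        using xy gdwn_P_axis [of x] gdwn_P_axis [of y] gdwn_P_diagonal [of x] Pair by auto
      then show ?thesis by simp
    next
      case 2
      then show ?thesis using xy Pair by (simp add: gdwn_upper_set_def)
    next
      case 3
      then have "(y, x) \<in> gdwn_upper_set" using xy by (simp add: gdwn_upper_set_def)
      then have "p \<in> prod.swap ` gdwn_upper_set" using Pair by (force simp: image_iff)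
      then show ?thesis by simp
    qed
  qed
  then show ?thesis
    by (auto simp: gdwn_upper_set_def gdwn_P_zero gdwn_P_sym)
qed

lemma inj_on_fst_gdwn_upper_set: "inj_on fst gdwn_upper_set"
  by (auto simp: inj_on_def gdwn_upper_set_def dest: gdwn_P_column_unique)

lemma infinite_gdwn_upper_set: "infinite gdwn_upper_set"
proof
  assume "finite gdwn_upper_set"
  then have "finite (fst ` {p. gdwn_P p})" by (simp add: gdwn_P_set_decomp)
  moreover have "fst ` {p. gdwn_P p} = UNIV"
    using gdwn_P_column_exists by (force simp: image_iff)
  ultimately show False by simp
qed

lemma infinite_fst_gdwn_upper_set: "infinite (fst ` gdwn_upper_set)"
  using infinite_gdwn_upper_set inj_on_fst_gdwn_upper_set finite_imageD by blast

theorem gdwn_a_strict_mono: "strict_mono gdwn_a"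
proof (rule strict_monoI)
  fix m n :: nat assume "m < n"
  have pos: "0 < enumerate (fst ` gdwn_upper_set) k" for k
    using enumerate_in_set [OF infinite_fst_gdwn_upper_set, of k]
    by (auto simp: gdwn_upper_set_def)
  show "gdwn_a m < gdwn_a n"
    using \<open>m < n\<close> pos enumerate_mono [OF _ infinite_fst_gdwn_upper_set, of "m - 1" "n - 1"]
    by (auto simp: gdwn_a_def)
qed

lemma gdwn_ab_in_upper_set:
  assumes "n \<ge> 1"
  shows "(gdwn_a n, gdwn_b n) \<in> gdwn_upper_set"
proof -
  have "gdwn_a n \<in> fst ` gdwn_upper_set"
    using assms enumerate_in_set [OF infinite_fst_gdwn_upper_set] by (simp add: gdwn_a_def)
  then obtain y where y: "(gdwn_a n, y) \<in> gdwn_upper_set" by auto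
  then have "(THE y. (gdwn_a n, y) \<in> gdwn_upper_set) = y"
    by (rule the_equality) (use y gdwn_P_column_unique in \<open>auto simp: gdwn_upper_set_def\<close>)
  then show ?thesis using y assms by (simp add: gdwn_b_def)
qed

theorem gdwn_ab_range: "{(gdwn_a n, gdwn_b n) | n. n \<ge> 1} = gdwn_upper_set"
proof
  show "{(gdwn_a n, gdwn_b n) | n. n \<ge> 1} \<subseteq> gdwn_upper_set"
    using gdwn_ab_in_upper_set by auto
  show "gdwn_upper_set \<subseteq> {(gdwn_a n, gdwn_b n) | n. n \<ge> 1}"
  proof
    fix p assume p: "p \<in> gdwn_upper_set"
    then obtain k where "enumerate (fst ` gdwn_upper_set) k = fst p"
      using enumerate_Ex [OF infinite_fst_gdwn_upper_set] by blast
    then have a: "gdwn_a (Suc k) = fst p" by (simp add: gdwn_a_def)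
    then have "(gdwn_a (Suc k), gdwn_b (Suc k)) = p"
      using inj_on_fst_gdwn_upper_set gdwn_ab_in_upper_set [of "Suc k"] p
      by (auto simp: inj_on_def)
    then have "p = (gdwn_a (Suc k), gdwn_b (Suc k)) \<and> Suc k \<ge> 1" by simp
    then show "p \<in> {(gdwn_a n, gdwn_b n) | n. n \<ge> 1}" by blast
  qed
qed

theorem gdwn_P_set_eq:
  "{p. gdwn_P p} =
     {(gdwn_a n, gdwn_b n) | n. n \<ge> 1} \<union> {(gdwn_b n, gdwn_a n) | n. n \<ge> 1} \<union> {(0, 0)}"
proof -
  have "prod.swap ` gdwn_upper_set = {(gdwn_b n, gdwn_a n) | n. n \<ge> 1}"
    unfolding gdwn_ab_range [symmetric] by force
  then show ?thesis using gdwn_P_set_decomp gdwn_ab_range by auto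
qed

end

theory Submission
  imports Defs
begin

text \<open>Regard an upper P-position \<open>(a, b)\<close> as a point above the diagonal; \<open>p\<close> ranges over such pairs below.
  The void sector lies just above the line \<open>y = 2 * x\<close>. Moves of type \<open>(t, 2 * t)\<close> slide along lines
  of slope two, so each line \<open>y = 2 * x + d\<close> carries at most one P-position. If for every \<open>d > 0\<close> it
  does carry one, and with first coordinate at most \<open>61 * d\<close> (\<open>gdwn_steep_line_hit_early\<close>), then no
  pair has \<open>2 < b / a \<le> 2 + 1/62\<close>, because there \<open>d = b - 2 * a\<close> is at most \<open>a / 62\<close>. The ratio \<open>2\<close>
  itself is excluded by \<open>(0, 0)\<close>. As every line is hit, infinitely many pairs lie above the sector.

  Why every line is hit early: suppose that \<open>y = 2 * x + d\<close> carries no P-position with \<open>x \<le> X\<close>. The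
  point of this line in the column of a pair above it is an N-position, and the P-position that
  it can be moved to must be a pair above the line in an earlier column. So there is no first
  pair above the line, and all pairs with \<open>a \<le> X\<close> lie below it (\<open>gdwn_below_missed_steep_line\<close>).
  Such a strip cannot be long (\<open>gdwn_steep_strip_bounded\<close>). Let \<open>k\<close> be the number of these pairs and
  write \<open>a = (b - a) + (2 * a - b)\<close>. The differences \<open>b - a\<close> are distinct positive numbers, with
  sum at least \<open>k\<^sup>2 / 2\<close>. The numbers \<open>2 * a - b\<close> are distinct, exceed \<open>- d\<close>, and avoid all
  \<open>2 * b' - a'\<close>, which label the slope-two lines of the reflected pairs \<open>(b', a')\<close>; this raises
  their sum to at least \<open>3 * k\<^sup>2 / 5\<close> up to \<open>O(d * k)\<close>. On the other hand every positive integer is a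
  first or second coordinate and \<open>a < b\<close>, so at least half of every initial segment consists of
  first coordinates, and these \<open>k\<close> of them have sum at most \<open>k * (k + 1)\<close>. Hence \<open>k = O(d)\<close>.

  Why infinitely many pairs lie below the sector (\<open>gdwn_infinitely_many_flat\<close>): suppose that
  \<open>b > 2 * a\<close> for all but finitely many pairs. Then some \<open>d > 0\<close> is not a difference \<open>b - a\<close>. For a
  large first coordinate \<open>x\<close> the point \<open>(x, x + d)\<close> lies below the P-position of its column, and
  inspection of the moves shows that \<open>x + d\<close> is some \<open>b\<close>, or \<open>x - d\<close> or \<open>x + 2 * d\<close> is some
  \<open>2 * b - a\<close> (\<open>gdwn_charging\<close>). Counting alone gives \<open>A \<le> B + 2 * T\<close>, up to constants, for the
  numbers of first coordinates, second coordinates and values \<open>2 * b - a\<close> up to \<open>n\<close>; as \<open>T \<le> B\<close>, it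
  follows that \<open>A \<le> 3 * n / 4\<close>. Counting each \<open>x\<close> with weight \<open>n - x\<close> instead exploits that the
  numbers \<open>e = b - 2 * a\<close> are distinct: from \<open>b = 2 * a + e\<close> and \<open>2 * b - a = 3 * a + 2 * e\<close> the
  second coordinates have weight at most about \<open>3 * n\<^sup>2 / 22\<close> and the values \<open>2 * b - a\<close> at most about
  \<open>n\<^sup>2 / 12\<close>. Then all of \<open>{1..n}\<close> has weight at most about \<open>(2 * 3/22 + 2 / 12) * n\<^sup>2\<close>,
  which is less than its actual weight \<open>n\<^sup>2 / 2\<close>.\<close>

section \<open>Sums of quantities with controlled ranks\<close>

text \<open>A bound on the number of small values forces the values to be large on average. The \<open>j\<close>-th
  smallest value is at least \<open>(j - q) / p\<close>, and summation over \<open>j\<close> gives \<open>(k\<^sup>2 - 2 * q * k) / (2 * p)\<close>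
  for \<open>k\<close> values.\<close>

lemma rank_sum_lower_bound:
  fixes g :: "'a \<Rightarrow> real"
  assumes "finite I"
    and "\<And>j. j \<in> I \<Longrightarrow> real (card {i \<in> I. g i \<le> g j}) \<le> p * g j + q"
  shows "(real (card I))\<^sup>2 \<le> 2 * p * sum g I + 2 * q * real (card I)"
  using assms
proof (induction "card I" arbitrary: I)
  case 0
  then show ?case by simp
next
  case (Suc n)
  then have "I \<noteq> {}" by auto
  then have "Max (g ` I) \<in> g ` I" using Suc.prems(1) by simp
  then obtain m where "m \<in> I" "g m = Max (g ` I)" by auto
  then have m: "m \<in> I" "\<And>i. i \<in> I \<Longrightarrow> g i \<le> g m" using Suc.prems(1) by auto
  let ?J = "I - {m}"
  have cJ: "card ?J = n" using m(1) Suc by simp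
  have rank: "real (card {i \<in> ?J. g i \<le> g j}) \<le> p * g j + q" if "j \<in> ?J" for j
  proof -
    have "card {i \<in> ?J. g i \<le> g j} \<le> card {i \<in> I. g i \<le> g j}"
      using Suc.prems(1) by (intro card_mono) auto
    moreover have "real (card {i \<in> I. g i \<le> g j}) \<le> p * g j + q"
      using Suc.prems(2) [of j] that by blast
    ultimately show ?thesis by linarith
  qed
  have IH: "(real n)\<^sup>2 \<le> 2 * p * sum g ?J + 2 * q * real n"
    using Suc.hyps(1) [of ?J] rank Suc.prems(1) cJ by simp
  have "{i \<in> I. g i \<le> g m} = I" using m by auto
  then have "real (Suc n) \<le> p * g m + q" using Suc.prems(2) [OF m(1)] Suc.hyps(2) by simp
  moreover have "sum g I = g m + sum g ?J" using m(1) Suc.prems(1) by (simp add: sum.remove)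
  ultimately show ?case
    using IH unfolding Suc.hyps(2) [symmetric] by (simp add: power2_eq_square algebra_simps)
qed

text \<open>The dual estimate: the \<open>j\<close>-th smallest value is at most \<open>c * j\<close>.\<close>

lemma rank_sum_upper_bound:
  fixes g :: "'a \<Rightarrow> real"
  assumes "finite I" "inj_on g I"
    and "\<And>j. j \<in> I \<Longrightarrow> g j \<le> c * real (card {i \<in> I. g i \<le> g j})"
  shows "2 * sum g I \<le> c * real (card I) * (real (card I) + 1)"
  using assms
proof (induction "card I" arbitrary: I)
  case 0
  then show ?case by simp
next
  case (Suc n)
  then have "I \<noteq> {}" by auto
  then have "Max (g ` I) \<in> g ` I" using Suc.prems(1) by simp
  then obtain m where "m \<in> I" "g m = Max (g ` I)" by auto
  then have m: "m \<in> I" "\<And>i. i \<in> I \<Longrightarrow> g i \<le> g m" using Suc.prems(1) by auto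
  let ?J = "I - {m}"
  have cJ: "card ?J = n" using m(1) Suc by simp
  have rank: "g j \<le> c * real (card {i \<in> ?J. g i \<le> g j})" if "j \<in> ?J" for j
  proof -
    have "g j < g m"
      using that m Suc.prems(2) by (metis DiffE inj_onD insertI1 order_le_less)
    then have "{i \<in> ?J. g i \<le> g j} = {i \<in> I. g i \<le> g j}" by auto
    then show ?thesis using Suc.prems(3) that by simp
  qed
  have "inj_on g ?J" using Suc.prems(2) by (rule inj_on_diff)
  then have IH: "2 * sum g ?J \<le> c * real n * (real n + 1)"
    using Suc.hyps(1) [of ?J] rank Suc.prems(1) cJ by simp
  have "{i \<in> I. g i \<le> g m} = I" using m by auto
  then have "g m \<le> c * real (Suc n)" using Suc.prems(3) [OF m(1)] Suc.hyps(2) by simp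
  moreover have "sum g I = g m + sum g ?J" using m(1) Suc.prems(1) by (simp add: sum.remove)
  ultimately show ?case
    using IH unfolding Suc.hyps(2) [symmetric] by (simp add: algebra_simps)
qed

lemma card_le_of_int_range:
  fixes h :: "'a \<Rightarrow> int"
  assumes "inj_on h I" "\<And>i. i \<in> I \<Longrightarrow> l < h i \<and> h i \<le> u" "l \<le> u"
  shows "real (card I) \<le> u - l"
proof -
  have "card I = card (h ` I)" using assms(1) by (simp add: card_image)
  also have "\<dots> \<le> card {l<..u}" using assms(2) by (intro card_mono) auto
  finally show ?thesis using assms(3) by (simp add: of_nat_diff)
qed

section \<open>P-positions on a common line of moves\<close>

lemma gdwn_P_diagonal_collinear:
  assumes "gdwn_P (x, y)" "gdwn_P (x + t, y + t)"
  shows "t = 0"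
proof (rule ccontr)
  assume "t \<noteq> 0"
  then have "(x, y) = (x + t - t, y + t - t) \<and> 0 < t \<and> t \<le> x + t \<and> t \<le> y + t" by simp
  then have "(x, y) \<in> gdwn_moves (x + t, y + t)" unfolding gdwn_moves_def by blast
  then show False using assms gdwn_P_not_option by blast
qed

lemma gdwn_P_steep_collinear:
  assumes "gdwn_P (x, y)" "gdwn_P (x + t, y + 2 * t)"
  shows "t = 0"
proof (rule ccontr)
  assume "t \<noteq> 0"
  then have "(x, y) = (x + t - t, y + 2 * t - 2 * t) \<and> 0 < t \<and> t \<le> x + t \<and> 2 * t \<le> y + 2 * t"
    by simp
  then have "(x, y) \<in> gdwn_moves (x + t, y + 2 * t)" unfolding gdwn_moves_def by blast
  then show False using assms gdwn_P_not_option by blast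
qed

text \<open>Each kind of move leaves a linear form invariant and reaches every earlier lattice point with the
  same value of the form, so a P-position is determined by that value.\<close>

lemma gdwn_P_diagonal_unique:
  assumes "gdwn_P (x, y)" "gdwn_P (x', y')" "int y - int x = int y' - int x'"
  shows "x = x' \<and> y = y'"
proof (cases "x \<le> x'")
  case True
  then have "x' = x + (x' - x)" "y' = y + (x' - x)" using assms(3) by auto
  then show ?thesis using gdwn_P_diagonal_collinear [of x y "x' - x"] assms by auto
next
  case False
  then have "x = x' + (x - x')" "y = y' + (x - x')" using assms(3) by auto
  then show ?thesis using gdwn_P_diagonal_collinear [of x' y' "x - x'"] assms by auto
qed

lemma gdwn_P_steep_unique:
  assumes "gdwn_P (x, y)" "gdwn_P (x', y')" "int y - 2 * int x = int y' - 2 * int x'"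
  shows "x = x' \<and> y = y'"
proof (cases "x \<le> x'")
  case True
  then have "x' = x + (x' - x)" "y' = y + 2 * (x' - x)" using assms(3) by auto
  then show ?thesis using gdwn_P_steep_collinear [of x y "x' - x"] assms by auto
next
  case False
  then have "x = x' + (x - x')" "y = y' + 2 * (x - x')" using assms(3) by auto
  then show ?thesis using gdwn_P_steep_collinear [of x' y' "x - x'"] assms by auto
qed

lemma gdwn_P_optionE:
  assumes "\<not> gdwn_P (x, y)"
  obtains (horizontal) t where "0 < t" "t \<le> x" "gdwn_P (x - t, y)"
    | (vertical) t where "0 < t" "t \<le> y" "gdwn_P (x, y - t)"
    | (diagonal) t where "0 < t" "t \<le> x" "t \<le> y" "gdwn_P (x - t, y - t)"
    | (steep) t where "0 < t" "t \<le> x" "2 * t \<le> y" "gdwn_P (x - t, y - 2 * t)"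
    | (shallow) t where "0 < t" "2 * t \<le> x" "t \<le> y" "gdwn_P (x - 2 * t, y - t)"
proof -
  obtain q where "q \<in> gdwn_moves (x, y)" "gdwn_P q"
    using assms gdwn_P.simps by blast
  then show ?thesis
    unfolding gdwn_moves_def by (auto intro: that)
qed

lemma gdwn_upper_iff: "(x, y) \<in> gdwn_upper_set \<longleftrightarrow> gdwn_P (x, y) \<and> x < y"
  using gdwn_P_axis by (cases "x = 0") (auto simp: gdwn_upper_set_def)

lemma gdwn_upperD:
  assumes "p \<in> gdwn_upper_set"
  shows "gdwn_P (fst p, snd p)" "gdwn_P (snd p, fst p)" "0 < fst p" "fst p < snd p"
  using assms by (auto simp: gdwn_upper_set_def gdwn_P_sym)

lemma inj_on_snd_gdwn_upper_set: "inj_on snd gdwn_upper_set"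
proof (rule inj_onI)
  fix p q assume "p \<in> gdwn_upper_set" "q \<in> gdwn_upper_set" "snd p = snd q"
  then show "p = q"
    using gdwn_P_column_unique [of "snd p" "fst p" "fst q"] gdwn_upperD(2) [of p]
      gdwn_upperD(2) [of q] by (simp add: prod_eq_iff)
qed

lemma inj_on_gdwn_difference:
  "inj_on (\<lambda>p. int (snd p) - int (fst p)) gdwn_upper_set"
proof (rule inj_onI)
  fix p q assume "p \<in> gdwn_upper_set" "q \<in> gdwn_upper_set"
    "int (snd p) - int (fst p) = int (snd q) - int (fst q)"
  then show "p = q"
    using gdwn_P_diagonal_unique [of "fst p" "snd p" "fst q" "snd q"] gdwn_upperD(1)
    by (simp add: prod_eq_iff)
qed

lemma inj_on_gdwn_excess:
  "inj_on (\<lambda>p. int (snd p) - 2 * int (fst p)) gdwn_upper_set"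
proof (rule inj_onI)
  fix p q assume "p \<in> gdwn_upper_set" "q \<in> gdwn_upper_set"
    "int (snd p) - 2 * int (fst p) = int (snd q) - 2 * int (fst q)"
  then show "p = q"
    using gdwn_P_steep_unique [of "fst p" "snd p" "fst q" "snd q"] gdwn_upperD(1)
    by (simp add: prod_eq_iff)
qed

text \<open>These are the slope-two lines through the reflected positions \<open>(b, a)\<close>.\<close>

lemma inj_on_gdwn_mirror_deficit:
  "inj_on (\<lambda>p. 2 * int (snd p) - int (fst p)) gdwn_upper_set"
proof (rule inj_onI)
  fix p q assume "p \<in> gdwn_upper_set" "q \<in> gdwn_upper_set"
    "2 * int (snd p) - int (fst p) = 2 * int (snd q) - int (fst q)"
  then show "p = q"
    using gdwn_P_steep_unique [of "snd p" "fst p" "snd q" "fst q"] gdwn_upperD(2)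
    by (simp add: prod_eq_iff)
qed

text \<open>An upper position and a reflected one never share a line of slope two.\<close>

lemma gdwn_deficit_neq_mirror_deficit:
  assumes "p \<in> gdwn_upper_set" "q \<in> gdwn_upper_set"
  shows "2 * int (fst p) - int (snd p) \<noteq> 2 * int (snd q) - int (fst q)"
proof
  assume "2 * int (fst p) - int (snd p) = 2 * int (snd q) - int (fst q)"
  then have "fst p = snd q \<and> snd p = fst q"
    using gdwn_P_steep_unique [of "fst p" "snd p" "snd q" "fst q"] gdwn_upperD assms by simp
  then show False using gdwn_upperD(4) assms by (metis not_less_iff_gr_or_eq)
qed

section \<open>Counting coordinates\<close>

lemma finite_gdwn_upper_fst_le: "finite {p \<in> gdwn_upper_set. fst p \<le> n}"
  by (rule inj_on_finite [of fst _ "{..n}"])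
    (auto intro: inj_on_subset [OF inj_on_fst_gdwn_upper_set])

lemma finite_gdwn_upper_snd_le: "finite {p \<in> gdwn_upper_set. snd p \<le> n}"
  by (rule finite_subset [OF _ finite_gdwn_upper_fst_le [of n]]) (auto dest: gdwn_upperD(4))

lemma gdwn_coordinates_cover: "0 < x \<Longrightarrow> x \<in> fst ` gdwn_upper_set \<union> snd ` gdwn_upper_set"
proof -
  assume "0 < x"
  obtain y where y: "gdwn_P (x, y)" using gdwn_P_column_exists by blast
  then have "y \<noteq> x" using \<open>0 < x\<close> gdwn_P_diagonal by blast
  then consider "(x, y) \<in> gdwn_upper_set" | "(y, x) \<in> gdwn_upper_set"
    using y gdwn_P_sym [of y x] by (cases "x < y") (auto simp: gdwn_upper_iff)
  then show ?thesis by cases force+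
qed

lemma gdwn_coordinates_disjoint: "fst ` gdwn_upper_set \<inter> snd ` gdwn_upper_set = {}"
proof -
  have False if "p \<in> gdwn_upper_set" "q \<in> gdwn_upper_set" "fst p = snd q" for p q
    using that gdwn_P_column_unique [of "fst p" "snd p" "fst q"] gdwn_upperD
    by (metis less_asym)
  then show ?thesis by blast
qed

lemma gdwn_sum_over_coordinates:
  fixes g :: "nat \<Rightarrow> nat"
  shows "sum g {1..n} = (\<Sum>p | p \<in> gdwn_upper_set \<and> fst p \<le> n. g (fst p))
    + (\<Sum>p | p \<in> gdwn_upper_set \<and> snd p \<le> n. g (snd p))"
proof -
  let ?A = "{p \<in> gdwn_upper_set. fst p \<le> n}" and ?B = "{p \<in> gdwn_upper_set. snd p \<le> n}"
  have "{1..n} \<subseteq> fst ` ?A \<union> snd ` ?B"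
  proof
    fix x assume "x \<in> {1..n}"
    then have "0 < x" "x \<le> n" by auto
    then show "x \<in> fst ` ?A \<union> snd ` ?B" using gdwn_coordinates_cover [of x] by auto
  qed
  moreover have "fst ` ?A \<union> snd ` ?B \<subseteq> {1..n}"
    by (auto dest: gdwn_upperD(3,4))
  ultimately have eq: "{1..n} = fst ` ?A \<union> snd ` ?B" by blast
  have "sum g {1..n} = sum g (fst ` ?A) + sum g (snd ` ?B)"
    unfolding eq using gdwn_coordinates_disjoint
    by (intro sum.union_disjoint) (auto simp: finite_gdwn_upper_fst_le finite_gdwn_upper_snd_le)
  moreover have "inj_on fst ?A" "inj_on snd ?B"
    by (auto intro: inj_on_subset [OF inj_on_fst_gdwn_upper_set]
        inj_on_subset [OF inj_on_snd_gdwn_upper_set])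
  ultimately show ?thesis by (simp add: sum.reindex)
qed

lemma gdwn_count_complementary:
  "card {p \<in> gdwn_upper_set. fst p \<le> n} + card {p \<in> gdwn_upper_set. snd p \<le> n} = n"
  using gdwn_sum_over_coordinates [of "\<lambda>_. 1" n] by simp

text \<open>Each second coordinate up to \<open>n\<close> is paired with a smaller first coordinate.\<close>

lemma gdwn_fst_count_ge_half: "n \<le> 2 * card {p \<in> gdwn_upper_set. fst p \<le> n}"
proof -
  have "card {p \<in> gdwn_upper_set. snd p \<le> n} \<le> card {p \<in> gdwn_upper_set. fst p \<le> n}"
    by (intro card_mono finite_gdwn_upper_fst_le) (auto dest: gdwn_upperD(4))
  then show ?thesis using gdwn_count_complementary [of n] by simp
qed

section \<open>Every line of slope two above the origin is hit early\<close>

text \<open>The missed point in the column of a first pair above the line would have no P-position among its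
  options: the column contains its P-position higher up, the line itself carries none, and the
  horizontal, diagonal and shallow moves lead to points above the line in earlier columns.\<close>

lemma gdwn_below_missed_steep_line:
  assumes "0 < d"
    and missed: "\<And>x. x \<le> X \<Longrightarrow> \<not> gdwn_P (x, 2 * x + d)"
    and "(a, b) \<in> gdwn_upper_set" "a \<le> X"
  shows "b < 2 * a + d"
  using assms(3,4)
proof (induction a arbitrary: b rule: less_induct)
  case (less a)
  show ?case
  proof (rule ccontr)
    assume "\<not> b < 2 * a + d"
    moreover have P: "gdwn_P (a, b)" using less.prems by (simp add: gdwn_upper_iff)
    ultimately have b: "2 * a + d < b" using missed [OF less.prems(2)] by (cases "b = 2 * a + d") auto
    from missed [OF less.prems(2)] show False
    proof (cases rule: gdwn_P_optionE)
      case (horizontal t)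
      then have "a - t < 2 * a + d" "a - t \<le> X" using less.prems(2) by linarith+
      then show False using horizontal less.IH [of "a - t" "2 * a + d"] less.prems(2)
        by (simp add: gdwn_upper_iff)
    next
      case (vertical t)
      then show False using gdwn_P_column_unique [OF P] b by fastforce
    next
      case (diagonal t)
      then have "a - t < a" "a - t \<le> X" "a - t < 2 * a + d - t"
        "\<not> 2 * a + d - t < 2 * (a - t) + d"
        using less.prems(2) assms(1) by linarith+
      then show False using less.IH [of "a - t" "2 * a + d - t"] diagonal
        by (simp add: gdwn_upper_iff)
    next
      case (steep t)
      then have "2 * a + d - 2 * t = 2 * (a - t) + d" by simp
      then show False using missed [of "a - t"] steep less.prems(2) by simp
    next
      case (shallow t)
      then have "a - 2 * t < a" "a - 2 * t \<le> X" "a - 2 * t < 2 * a + d - t"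
        "\<not> 2 * a + d - t < 2 * (a - 2 * t) + d"
        using less.prems(2) assms(1) by linarith+
      then show False using less.IH [of "a - 2 * t" "2 * a + d - t"] shallow
        by (simp add: gdwn_upper_iff)
    qed
  qed
qed

text \<open>In the strip between the diagonal and \<open>y = 2 * x + d\<close> both summands of
  \<open>a = (b - a) + (2 * a - b)\<close> take distinct values, bounded below by \<open>0\<close> and by \<open>- d\<close>. This alone
  makes the sum of the first coordinates at least about \<open>k\<^sup>2\<close>, which just fails to contradict the
  upper bound \<open>k * (k + 1)\<close>. The values \<open>2 * b - a\<close>, which \<open>2 * a - b\<close> has to avoid, make the
  difference.\<close>

lemma gdwn_steep_strip_bounded:
  assumes strip: "\<And>p. p \<in> gdwn_upper_set \<Longrightarrow> fst p \<le> X \<Longrightarrow> snd p < 2 * fst p + d"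
  shows "X \<le> 32 * d + 28"
proof -
  define I where "I = {p \<in> gdwn_upper_set. fst p \<le> X}"
  define k where "k = real (card I)"
  define df where "df = (\<lambda>p :: nat \<times> nat. int (snd p) - int (fst p))"
  define c where "c = (\<lambda>p :: nat \<times> nat. 2 * int (fst p) - int (snd p))"
  define m where "m = (\<lambda>p :: nat \<times> nat. 2 * int (snd p) - int (fst p))"
  have fin: "finite I" unfolding I_def by (rule finite_gdwn_upper_fst_le)
  have U: "p \<in> gdwn_upper_set" "fst p \<le> X" "snd p < 2 * fst p + d" "0 < fst p" "fst p < snd p"
    if "p \<in> I" for p
    using that strip gdwn_upperD by (auto simp: I_def)
  have IU: "I \<subseteq> gdwn_upper_set" by (auto simp: I_def)
  have inj_df: "inj_on df I"
    unfolding df_def by (rule inj_on_subset [OF inj_on_gdwn_difference IU])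
  have inj_m: "inj_on m I"
    unfolding m_def by (rule inj_on_subset [OF inj_on_gdwn_mirror_deficit IU])
  have inj_c: "inj_on c I"
    using inj_on_subset [OF inj_on_gdwn_excess IU] unfolding c_def inj_on_def
    by (smt (verit))
  have sum_df: "k\<^sup>2 \<le> 2 * (\<Sum>p\<in>I. real_of_int (df p))"
  proof -
    have "real (card {i \<in> I. real_of_int (df i) \<le> real_of_int (df j)}) \<le> 1 * real_of_int (df j) + 0"
      if "j \<in> I" for j
    proof -
      have "real (card {i \<in> I. real_of_int (df i) \<le> real_of_int (df j)}) \<le> df j - 0"
      proof (rule card_le_of_int_range [of df])
        show "inj_on df {i \<in> I. real_of_int (df i) \<le> real_of_int (df j)}"
          by (rule inj_on_subset [OF inj_df]) auto
      qed (use U(5) that in \<open>auto simp: df_def less_imp_le\<close>)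
      then show ?thesis by simp
    qed
    from rank_sum_lower_bound [OF fin this] show ?thesis by (simp add: k_def)
  qed
  define q where "q = 4/3 * real d + 1/3"
  \<comment> \<open>Up to \<open>v\<close> at least \<open>v / 6\<close> numbers, up to a constant, have the form \<open>2 * b - a\<close>, since
    \<open>2 * b - a < 3 * a + 2 * d\<close> and first coordinates have density at least \<open>1/2\<close>. Only \<open>5 * v / 6\<close>
    numbers remain for \<open>2 * a - b\<close>.\<close>
  have sum_c: "k\<^sup>2 \<le> 2 * (5/6) * (\<Sum>p\<in>I. real_of_int (c p)) + 2 * q * k"
  proof -
    have "real (card {i \<in> I. real_of_int (c i) \<le> real_of_int (c j)}) \<le> 5/6 * real_of_int (c j) + q"
      if j: "j \<in> I" for j
    proof -
      define C where "C = {i \<in> I. c i \<le> c j}"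
      define T where "T = {i \<in> I. m i \<le> c j}"
      have finCT: "finite C" "finite T" using fin by (auto simp: C_def T_def)
      have low: "- int d < c i" if "i \<in> I" for i using U(3) [OF that] by (simp add: c_def)
      have mpos: "0 < m i" if "i \<in> I" for i using U(5) [OF that] by (simp add: m_def)
      have "card C + card T = card (c ` C) + card (m ` T)"
        using inj_c inj_m by (auto simp: C_def T_def card_image inj_on_def)
      also have "\<dots> = card (c ` C \<union> m ` T)"
      proof (rule card_Un_disjoint [symmetric])
        show "c ` C \<inter> m ` T = {}"
          using gdwn_deficit_neq_mirror_deficit U(1) by (fastforce simp: C_def T_def c_def m_def)
      qed (use finCT in auto)
      also have "\<dots> \<le> card {- int d<..c j}"
        using low mpos by (intro card_mono) (force simp: C_def T_def)+
      finally have CT: "real (card C) + real (card T) \<le> real_of_int (c j) + real d"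
        using low [OF j] by simp
      have "(c j - 2 * int d - 2) \<le> 6 * int (card T)"
      proof (cases "2 * int d \<le> c j")
        case True
        \<comment> \<open>Pairs with \<open>3 * a + 2 * d \<le> c j\<close> contribute to \<open>T\<close>.\<close>
        define n where "n = nat ((c j - 2 * int d) div 3)"
        have n: "3 * int n \<le> c j - 2 * int d" "c j - 2 * int d - 2 \<le> 3 * int n"
          using True by (auto simp: n_def)
        have "{p \<in> gdwn_upper_set. fst p \<le> n} \<subseteq> T"
        proof
          fix p assume p: "p \<in> {p \<in> gdwn_upper_set. fst p \<le> n}"
          have "c j \<le> int X" using U(2,5) [OF j] by (simp add: c_def)
          then have pI: "p \<in> I" using p n(1) by (auto simp: I_def)
          then have "m p \<le> c j" using U(3) [OF pI] p n(1) by (auto simp: m_def)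
          with pI show "p \<in> T" by (simp add: T_def)
        qed
        then have "card {p \<in> gdwn_upper_set. fst p \<le> n} \<le> card T"
          by (rule card_mono [OF finCT(2)])
        then show ?thesis using gdwn_fst_count_ge_half [of n] n(2) by linarith
      qed simp
      then have "real_of_int (c j) - 2 * real d - 2 \<le> 6 * real (card T)" by linarith
      with CT have "real (card C) \<le> 5/6 * real_of_int (c j) + q" unfolding q_def by linarith
      then show ?thesis by (simp add: C_def)
    qed
    from rank_sum_lower_bound [OF fin this] show ?thesis by (simp add: k_def)
  qed
  have sum_a: "2 * (\<Sum>p\<in>I. real (fst p)) \<le> 2 * k * (k + 1)"
  proof -
    have "real (fst j) \<le> 2 * real (card {i \<in> I. real (fst i) \<le> real (fst j)})" if "j \<in> I" for j
    proof -
      have "{i \<in> I. real (fst i) \<le> real (fst j)} = {p \<in> gdwn_upper_set. fst p \<le> fst j}"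
        using U(2) [OF that] by (auto simp: I_def)
      then show ?thesis using gdwn_fst_count_ge_half [of "fst j"] by simp
    qed
    moreover have "inj_on (\<lambda>p. real (fst p)) I"
      using inj_on_fst_gdwn_upper_set IU by (auto simp: inj_on_def)
    ultimately show ?thesis using rank_sum_upper_bound [OF fin] by (simp add: k_def)
  qed
  then have sum_a': "(\<Sum>p\<in>I. real (fst p)) \<le> k\<^sup>2 + k"
    by (simp add: power2_eq_square algebra_simps)
  have "(\<Sum>p\<in>I. real (fst p)) = (\<Sum>p\<in>I. real_of_int (df p)) + (\<Sum>p\<in>I. real_of_int (c p))"
    unfolding sum.distrib [symmetric] by (simp add: df_def c_def)
  \<comment> \<open>This is \<open>k\<^sup>2 / 2 + 3/5 * (k\<^sup>2 - 2 * q * k) \<le> k\<^sup>2 + k\<close>.\<close>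
  then have "k\<^sup>2 \<le> 10 * k + 12 * q * k"
    using sum_df sum_c sum_a' by linarith
  then have "k * k \<le> (10 + 12 * q) * k" by (simp add: power2_eq_square algebra_simps)
  moreover have "0 \<le> k" "0 \<le> q" by (auto simp: k_def q_def)
  ultimately have "k \<le> 10 + 12 * q"
    by (cases "k = 0") (auto simp: mult_le_cancel_right)
  then have "k \<le> 16 * d + 14" by (simp add: q_def field_simps)
  then show ?thesis
    using gdwn_fst_count_ge_half [of X] unfolding k_def I_def by linarith
qed

text \<open>The bound \<open>32 * d + 28\<close> on the length of a strip is less than \<open>61 * d\<close> for all \<open>d > 0\<close>.\<close>

lemma gdwn_steep_line_hit_early:
  assumes "0 < d"
  shows "\<exists>x \<le> 61 * d. (x, 2 * x + d) \<in> gdwn_upper_set"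
proof (rule ccontr)
  assume none: "\<not> ?thesis"
  then have "\<not> gdwn_P (x, 2 * x + d)" if "x \<le> 61 * d" for x
    using that assms by (auto simp: gdwn_upper_iff)
  then have "snd p < 2 * fst p + d" if "p \<in> gdwn_upper_set" "fst p \<le> 61 * d" for p
    using gdwn_below_missed_steep_line [OF assms, of "61 * d" "fst p" "snd p"] that by auto
  from gdwn_steep_strip_bounded [of "61 * d" d, OF this] show False using assms by simp
qed

section \<open>Infinitely many pairs lie below slope two\<close>

text \<open>A pair with \<open>b > 2 * a\<close> has a difference larger than \<open>a\<close>, so differences up to \<open>M + 1\<close> come from first
  coordinates at most \<open>M\<close>, of which there are not enough.\<close>

lemma gdwn_missed_difference:
  assumes steep: "\<And>p. p \<in> gdwn_upper_set \<Longrightarrow> M < fst p \<Longrightarrow> 2 * fst p < snd p"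
  shows "\<exists>d > 0. \<forall>p \<in> gdwn_upper_set. snd p - fst p \<noteq> d"
proof (rule ccontr)
  assume "\<not> ?thesis"
  then have hit: "\<exists>p \<in> gdwn_upper_set. snd p - fst p = d" if "0 < d" for d using that by blast
  let ?n = "Suc M"
  let ?S = "{p \<in> gdwn_upper_set. fst p \<le> M}"
  have "{1..?n} \<subseteq> (\<lambda>p. snd p - fst p) ` ?S"
  proof
    fix d assume d: "d \<in> {1..?n}"
    then obtain p where p: "p \<in> gdwn_upper_set" "snd p - fst p = d" using hit [of d] by auto
    then have "fst p \<le> M" using steep [OF p(1)] d by (cases "M < fst p") auto
    then show "d \<in> (\<lambda>p. snd p - fst p) ` ?S" using p by blast
  qed
  then have "card {1..?n} \<le> card ?S"
    by (rule surj_card_le [OF finite_gdwn_upper_fst_le])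
  then show False using gdwn_count_complementary [of M] by simp
qed

text \<open>The point \<open>(x, x + d)\<close> lies below the P-position of its column, so one of its other options is a
  P-position: the three alternatives are a horizontal move, a steep move to a reflected position
  and a shallow move. A diagonal move would make \<open>d\<close> a difference, and a steep move to an upper
  position would lead below slope two in a late column.\<close>

lemma gdwn_charging:
  assumes steep: "\<And>p. p \<in> gdwn_upper_set \<Longrightarrow> M < fst p \<Longrightarrow> 2 * fst p < snd p"
    and "0 < d" and missed: "\<And>p. p \<in> gdwn_upper_set \<Longrightarrow> snd p - fst p \<noteq> d"
    and x: "(x, z) \<in> gdwn_upper_set" "M + d < x"
  shows "\<exists>p \<in> gdwn_upper_set. snd p = x + d \<or> 2 * snd p - fst p + d = x \<or> 2 * snd p - fst p = x + 2 * d"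
proof -
  have z: "2 * x < z" "gdwn_P (x, z)" using steep [OF x(1)] x by (auto simp: gdwn_upper_iff)
  have "\<not> gdwn_P (x, x + d)" using gdwn_P_column_unique [OF z(2)] z(1) x(2) by fastforce
  then show ?thesis
  proof (cases rule: gdwn_P_optionE)
    case (horizontal t)
    then have "(x - t, x + d) \<in> gdwn_upper_set" using \<open>0 < d\<close> by (simp add: gdwn_upper_iff)
    then show ?thesis by force
  next
    case (vertical t)
    then show ?thesis using gdwn_P_column_unique [OF z(2)] z(1) x(2) by fastforce
  next
    case (diagonal t)
    then have "(x - t, x + d - t) \<in> gdwn_upper_set" using \<open>0 < d\<close> by (simp add: gdwn_upper_iff)
    then show ?thesis using missed diagonal by fastforce
  next
    case (steep t)
    consider "t < d" | "t = d" | "d < t" by linarith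
    then show ?thesis
    proof cases
      case 1
      then have "(x - t, x + d - 2 * t) \<in> gdwn_upper_set" using steep by (simp add: gdwn_upper_iff)
      \<comment> \<open>As \<open>d < x\<close> the target lies below slope two, and as \<open>t < d\<close> its first coordinate exceeds \<open>M\<close>.\<close>
      moreover have "M < x - t" using 1 x(2) by linarith
      ultimately have "2 * (x - t) < x + d - 2 * t" using assms(1) by fastforce
      then have False using steep x(2) by linarith
      then show ?thesis ..
    next
      case 2
      then show ?thesis using gdwn_P_diagonal [of "x - d"] steep x(2) by simp
    next
      case 3
      then have "(x + d - 2 * t, x - t) \<in> gdwn_upper_set"
        using steep by (auto simp: gdwn_upper_iff gdwn_P_sym)
      moreover have "2 * (x - t) - (x + d - 2 * t) + d = x" using steep x(2) by auto
      ultimately show ?thesis by force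
    qed
  next
    case (shallow t)
    then have "(x - 2 * t, x + d - t) \<in> gdwn_upper_set" by (simp add: gdwn_upper_iff)
    moreover have "2 * (x + d - t) - (x - 2 * t) = x + 2 * d" using shallow by auto
    ultimately show ?thesis by force
  qed
qed

text \<open>Summation of an arbitrary weight over the alternatives of \<open>gdwn_charging\<close>. The weight \<open>1\<close> yields a
  density bound, and the weight \<open>n - x\<close> the final contradiction. The margin \<open>2 * d\<close> in the ranges
  covers the shifts by \<open>d\<close> and \<open>2 * d\<close>.\<close>

lemma gdwn_weighted_charging:
  fixes g :: "nat \<Rightarrow> nat" and n d :: nat
  assumes steep: "\<And>p. p \<in> gdwn_upper_set \<Longrightarrow> M < fst p \<Longrightarrow> 2 * fst p < snd p"
    and d: "0 < d" and missed: "\<And>p. p \<in> gdwn_upper_set \<Longrightarrow> snd p - fst p \<noteq> d"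
  defines "J \<equiv> {p \<in> gdwn_upper_set. snd p \<le> n + 2 * d}"
    and "K \<equiv> {p \<in> gdwn_upper_set. 2 * snd p - fst p \<le> n + 2 * d}"
  shows "(\<Sum>p | p \<in> gdwn_upper_set \<and> fst p \<le> n. g (fst p))
    \<le> sum g {..M + d} + (\<Sum>p\<in>J. g (snd p - d))
      + (\<Sum>p\<in>K. g (2 * snd p - fst p + d)) + (\<Sum>p\<in>K. g (2 * snd p - fst p - 2 * d))"
proof -
  have finJ: "finite J" unfolding J_def by (rule finite_gdwn_upper_snd_le)
  have "K \<subseteq> J" unfolding J_def K_def by (auto dest: gdwn_upperD(4))
  then have finK: "finite K" using finJ finite_subset by blast
  let ?A = "{p \<in> gdwn_upper_set. fst p \<le> n}"
  let ?f1 = "\<lambda>p. snd p - d" and ?f2 = "\<lambda>p. 2 * snd p - fst p + d"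
    and ?f3 = "\<lambda>p. 2 * snd p - fst p - 2 * d"
  let ?V = "{..M + d} \<union> ?f1 ` J \<union> ?f2 ` K \<union> ?f3 ` K"
  have "fst ` ?A \<subseteq> ?V"
  proof
    fix x assume "x \<in> fst ` ?A"
    then obtain z where z: "(x, z) \<in> gdwn_upper_set" "x \<le> n" by auto
    show "x \<in> ?V"
    proof (cases "x \<le> M + d")
      case False
      then obtain p where p: "p \<in> gdwn_upper_set"
        "snd p = x + d \<or> 2 * snd p - fst p + d = x \<or> 2 * snd p - fst p = x + 2 * d"
        using gdwn_charging [of M d x z, OF steep d missed z(1)] False by fastforce
      from p(2) consider "p \<in> J" "x = ?f1 p" | "p \<in> K" "x = ?f2 p" | "p \<in> K" "x = ?f3 p"
        using p(1) z(2) unfolding J_def K_def by fastforce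
      then show ?thesis by cases blast+
    qed simp
  qed
  then have "sum g (fst ` ?A) \<le> sum g ?V"
    using finJ finK by (intro sum_mono2) auto
  also have "\<dots> \<le> sum g {..M + d} + sum g (?f1 ` J) + sum g (?f2 ` K) + sum g (?f3 ` K)"
  proof -
    have un: "sum g (S \<union> T) \<le> sum g S + sum g T" if "finite S" "finite T" for S T
      using sum.union_inter [OF that, of g] by linarith
    show ?thesis
      using un [of "{..M + d} \<union> ?f1 ` J \<union> ?f2 ` K" "?f3 ` K"]
        un [of "{..M + d} \<union> ?f1 ` J" "?f2 ` K"] un [of "{..M + d}" "?f1 ` J"] finJ finK
      by simp
  qed
  also have "\<dots> \<le> sum g {..M + d} + sum (g \<circ> ?f1) J + sum (g \<circ> ?f2) K + sum (g \<circ> ?f3) K"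
    using finJ finK by (intro add_mono sum_image_le order_refl) auto
  finally show ?thesis
    using inj_on_subset [OF inj_on_fst_gdwn_upper_set, of ?A] by (simp add: sum.reindex o_def)
qed

text \<open>If almost all pairs had \<open>b > 2 * a\<close>, second coordinates and values \<open>2 * b - a\<close> would be too sparse to
  take all the charges of \<open>gdwn_weighted_charging\<close>. Bounds that only use distinctness of the first
  coordinates and of \<open>b - 2 * a\<close> would just miss a contradiction (\<open>2/6 + 2/10 > 1/2\<close>), whence the
  preliminary bound \<open>3/4\<close> on the density of first coordinates.\<close>

lemma gdwn_infinitely_many_flat:
  "infinite {p \<in> gdwn_upper_set. snd p < 2 * fst p}"
proof
  assume "finite {p \<in> gdwn_upper_set. snd p < 2 * fst p}"
  then have "finite (fst ` {p \<in> gdwn_upper_set. snd p < 2 * fst p})" by simp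
  then obtain M where M: "\<And>p. p \<in> gdwn_upper_set \<Longrightarrow> snd p < 2 * fst p \<Longrightarrow> fst p \<le> M"
    unfolding finite_nat_set_iff_bounded_le by blast
  have steep: "2 * fst p < snd p" if "p \<in> gdwn_upper_set" "M < fst p" for p
  proof -
    have "snd p \<noteq> 2 * fst p"
    proof
      assume "snd p = 2 * fst p"
      then have "gdwn_P (0 + fst p, 0 + 2 * fst p)" using gdwn_upperD(1) [OF that(1)] by simp
      then show False
        using gdwn_P_steep_collinear [OF gdwn_P_zero, of "fst p"] gdwn_upperD(3) [OF that(1)]
        by simp
    qed
    then show ?thesis using M [OF that(1)] that(2) by linarith
  qed
  obtain d where d: "0 < d" and missed: "\<And>p. p \<in> gdwn_upper_set \<Longrightarrow> snd p - fst p \<noteq> d"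
    using gdwn_missed_difference [OF steep] by blast
  let ?B = "\<lambda>n. {p \<in> gdwn_upper_set. snd p \<le> n}"
  let ?A = "\<lambda>n. {p \<in> gdwn_upper_set. fst p \<le> n}"
  let ?T = "\<lambda>n. {p \<in> gdwn_upper_set. 2 * snd p - fst p \<le> n}"
  have TB: "?T n \<subseteq> ?B n" for n by (auto dest: gdwn_upperD(4))
  \<comment> \<open>One constant that dominates all additive errors: the \<open>M + d + 1\<close> early columns, the shift by
    \<open>2 * d\<close>, and the lower bound \<open>- M\<close> on \<open>b - 2 * a\<close>.\<close>
  define c where "c = M + 3 * d + 1"
  have quarter: "4 * card (?A n) \<le> 3 * n + c" for n
  proof (cases "2 * d \<le> n")
    case True
    then have n: "n - 2 * d + 2 * d = n" by simp
    have "card (?T n) \<le> card (?B n)"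
      by (intro card_mono finite_gdwn_upper_snd_le TB)
    then have "card (?A (n - 2 * d)) \<le> M + d + 1 + 3 * card (?B n)"
      using gdwn_weighted_charging [where M = M, OF steep d missed, of "\<lambda>_. 1" "n - 2 * d"]
      unfolding n by simp
    moreover have "card (?B (n - 2 * d)) \<le> card (?B n)"
      by (intro card_mono finite_gdwn_upper_snd_le) auto
    ultimately show ?thesis
      using gdwn_count_complementary [of "n - 2 * d"] gdwn_count_complementary [of n] True
      unfolding c_def by linarith
  next
    case False
    then show ?thesis using gdwn_count_complementary [of n] unfolding c_def by linarith
  qed
  define e where "e = (\<lambda>p :: nat \<times> nat. int (snd p) - 2 * int (fst p))"
  have sums: "(real (card I))\<^sup>2 \<le> 3/2 * (\<Sum>p\<in>I. real (fst p)) + c / 2 * card I"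
    "(real (card I))\<^sup>2 \<le> 2 * (\<Sum>p\<in>I. real_of_int (e p)) + 2 * real c * card I"
    if I: "finite I" "I \<subseteq> gdwn_upper_set" for I
  proof -
    have "real (card {i \<in> I. real (fst i) \<le> real (fst j)}) \<le> 3/4 * real (fst j) + c / 4" for j
    proof -
      have "card {i \<in> I. real (fst i) \<le> real (fst j)} \<le> card (?A (fst j))"
        using I by (intro card_mono finite_gdwn_upper_fst_le) auto
      then show ?thesis using quarter [of "fst j"] by linarith
    qed
    from rank_sum_lower_bound [OF I(1) this]
    show "(real (card I))\<^sup>2 \<le> 3/2 * (\<Sum>p\<in>I. real (fst p)) + c / 2 * card I" by simp
    \<comment> \<open>Late pairs have a positive excess, early ones at least \<open>b - 2 * a > - a \<ge> - M\<close>.\<close>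
    have low: "- int c < e p" if "p \<in> I" for p
    proof -
      have p: "p \<in> gdwn_upper_set" using I(2) that by blast
      show ?thesis
        using steep [OF p] gdwn_upperD(4) [OF p] by (cases "M < fst p") (auto simp: e_def c_def)
    qed
    have "real (card {i \<in> I. real_of_int (e i) \<le> real_of_int (e j)}) \<le> 1 * real_of_int (e j) + c"
      if "j \<in> I" for j
    proof -
      have "inj_on e {i \<in> I. real_of_int (e i) \<le> real_of_int (e j)}"
        unfolding e_def by (rule inj_on_subset [OF inj_on_gdwn_excess]) (use I(2) in auto)
      then have "real (card {i \<in> I. real_of_int (e i) \<le> real_of_int (e j)}) \<le> e j - (- int c)"
        by (rule card_le_of_int_range) (use low that in \<open>auto simp: less_imp_le\<close>)
      then show ?thesis by simp
    qed
    from rank_sum_lower_bound [OF I(1) this]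
    show "(real (card I))\<^sup>2 \<le> 2 * (\<Sum>p\<in>I. real_of_int (e p)) + 2 * real c * card I" by simp
  qed
  \<comment> \<open>With \<open>m = n + 5/3 * c\<close>, the rank bounds give at most \<open>m * k - 11/6 * k\<^sup>2\<close>, whose
    maximum over \<open>k\<close> is \<open>3/22 * m\<^sup>2\<close>.\<close>
  have weight_B: "(\<Sum>p\<in>?B n. real n - real (snd p)) \<le> 3/22 * (real n + 5/3 * c)\<^sup>2" for n
  proof -
    let ?k = "real (card (?B n))"
    have "(\<Sum>p\<in>?B n. real (snd p))
        = 2 * (\<Sum>p\<in>?B n. real (fst p)) + (\<Sum>p\<in>?B n. real_of_int (e p))"
      unfolding sum_distrib_left sum.distrib [symmetric] by (simp add: e_def)
    moreover have "(\<Sum>p\<in>?B n. real n - real (snd p)) = real n * ?k - (\<Sum>p\<in>?B n. real (snd p))"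
      by (simp add: sum_subtractf)
    moreover have "?k\<^sup>2 \<le> 3/2 * (\<Sum>p\<in>?B n. real (fst p)) + c / 2 * ?k"
      "?k\<^sup>2 \<le> 2 * (\<Sum>p\<in>?B n. real_of_int (e p)) + 2 * real c * ?k"
      using sums [of "?B n"] finite_gdwn_upper_snd_le by auto
    moreover have "0 \<le> (3 * (real n + 5/3 * c) - 11 * ?k)\<^sup>2" by simp
    ultimately show ?thesis by (simp add: power2_eq_square algebra_simps)
  qed
  \<comment> \<open>In the same way, \<open>m * k - 3 * k\<^sup>2\<close> with \<open>m = n + 3 * c\<close> is at most \<open>m\<^sup>2 / 12\<close>.\<close>
  have weight_T: "(\<Sum>p\<in>?T n. real n - (2 * real (snd p) - real (fst p))) \<le> 1/12 * (real n + 3 * c)\<^sup>2"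
    for n
  proof -
    let ?k = "real (card (?T n))"
    have "(\<Sum>p\<in>?T n. 2 * real (snd p) - real (fst p))
        = 3 * (\<Sum>p\<in>?T n. real (fst p)) + 2 * (\<Sum>p\<in>?T n. real_of_int (e p))"
      unfolding sum_distrib_left sum.distrib [symmetric] by (simp add: e_def)
    moreover have "(\<Sum>p\<in>?T n. real n - (2 * real (snd p) - real (fst p)))
        = real n * ?k - (\<Sum>p\<in>?T n. 2 * real (snd p) - real (fst p))"
      by (simp only: sum_subtractf sum_constant of_nat_id mult.commute)
    moreover have "?k\<^sup>2 \<le> 3/2 * (\<Sum>p\<in>?T n. real (fst p)) + c / 2 * ?k"
      "?k\<^sup>2 \<le> 2 * (\<Sum>p\<in>?T n. real_of_int (e p)) + 2 * real c * ?k"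
      using sums [of "?T n"] finite_subset [OF TB finite_gdwn_upper_snd_le] by auto
    moreover have "0 \<le> ((real n + 3 * c) - 6 * ?k)\<^sup>2" by simp
    ultimately show ?thesis by (simp add: power2_eq_square algebra_simps)
  qed
  \<comment> \<open>Any \<open>n\<close> much larger than \<open>c\<close> works, because \<open>2 * 3/22 + 2/12 = 29/66 < 1/2\<close>. Truncated
    subtraction makes the weight \<open>g\<close> vanish beyond \<open>n\<close>.\<close>
  define n where "n = 1000 * c"
  define n' where "n' = n + 2 * d"
  define g where "g = (\<lambda>x. n - x)"
  have "real (sum g {1..n}) = real n * (real n - 1) / 2"
  proof -
    have "real (\<Sum>x\<in>{1..n}. n - x) = (\<Sum>x\<in>{1..n}. real n - real x)"
      by (simp add: of_nat_diff)
    also have "\<dots> = real n * real n - real (\<Sum>{1..n})" by (simp add: sum_subtractf)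
    also have "real (\<Sum>{1..n}) = real n * (real n + 1) / 2"
      using double_gauss_sum_from_Suc_0 [of n, where 'a = real] by simp
    finally show ?thesis by (simp add: g_def field_simps)
  qed
  moreover have "real (\<Sum>p\<in>?B n. g (snd p)) \<le> 3/22 * (real n' + 3 * c)\<^sup>2"
  proof -
    have "real (\<Sum>p\<in>?B n. g (snd p)) = (\<Sum>p\<in>?B n. real n - real (snd p))"
      by (simp add: g_def of_nat_diff)
    also have "\<dots> \<le> 3/22 * (real n + 5/3 * c)\<^sup>2" by (rule weight_B)
    also have "\<dots> \<le> 3/22 * (real n' + 3 * c)\<^sup>2"
      by (intro mult_left_mono power_mono) (auto simp: n'_def)
    finally show ?thesis .
  qed
  moreover have "real (\<Sum>p\<in>?B n'. g (snd p - d)) \<le> 3/22 * (real n' + 3 * c)\<^sup>2"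
  proof -
    have "real (\<Sum>p\<in>?B n'. g (snd p - d)) \<le> (\<Sum>p\<in>?B n'. real n' - real (snd p))"
      unfolding of_nat_sum by (intro sum_mono) (auto simp: g_def n'_def)
    also have "\<dots> \<le> 3/22 * (real n' + 5/3 * c)\<^sup>2" by (rule weight_B)
    also have "\<dots> \<le> 3/22 * (real n' + 3 * c)\<^sup>2"
      by (intro mult_left_mono power_mono) auto
    finally show ?thesis .
  qed
  moreover have "real (\<Sum>p\<in>?T n'. g (2 * snd p - fst p + d)) \<le> 1/12 * (real n' + 3 * c)\<^sup>2"
  proof -
    have "real (\<Sum>p\<in>?T n'. g (2 * snd p - fst p + d))
        \<le> (\<Sum>p\<in>?T n'. real n' - (2 * real (snd p) - real (fst p)))"
      unfolding of_nat_sum by (intro sum_mono) (auto simp: g_def n'_def dest: gdwn_upperD(4))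
    then show ?thesis using weight_T [of n'] by linarith
  qed
  moreover have "real (\<Sum>p\<in>?T n'. g (2 * snd p - fst p - 2 * d)) \<le> 1/12 * (real n' + 3 * c)\<^sup>2"
  proof -
    have "real (\<Sum>p\<in>?T n'. g (2 * snd p - fst p - 2 * d))
        \<le> (\<Sum>p\<in>?T n'. real n' - (2 * real (snd p) - real (fst p)))"
      unfolding of_nat_sum by (intro sum_mono) (auto simp: g_def n'_def dest: gdwn_upperD(4))
    then show ?thesis using weight_T [of n'] by linarith
  qed
  moreover have "real (sum g {..M + d}) \<le> real c * real n"
  proof -
    have "sum g {..M + d} \<le> card {..M + d} * n"
      using sum_bounded_above [of "{..M + d}" g n] by (simp add: g_def)
    also have "\<dots> \<le> c * n" by (intro mult_right_mono) (auto simp: c_def)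
    finally show ?thesis unfolding of_nat_mult [symmetric] of_nat_le_iff .
  qed
  moreover have "real (sum g {1..n}) = real (\<Sum>p\<in>?A n. g (fst p)) + real (\<Sum>p\<in>?B n. g (snd p))"
    unfolding gdwn_sum_over_coordinates by simp
  moreover have "real (\<Sum>p\<in>?A n. g (fst p)) \<le> real (sum g {..M + d})
    + real (\<Sum>p\<in>?B n'. g (snd p - d)) + real (\<Sum>p\<in>?T n'. g (2 * snd p - fst p + d))
    + real (\<Sum>p\<in>?T n'. g (2 * snd p - fst p - 2 * d))"
    using gdwn_weighted_charging [where M = M, OF steep d missed, of g n]
    unfolding n'_def of_nat_add [symmetric] of_nat_le_iff .
  ultimately have "real n * (real n - 1) / 2 \<le> real c * real n + 29/66 * (real n' + 3 * c)\<^sup>2"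
    by argo
  also have "\<dots> \<le> real c * real n + 29/66 * (1004 * real c)\<^sup>2"
    by (intro add_left_mono mult_left_mono power_mono) (auto simp: n'_def n_def c_def)
  finally have "498000 * (real c)\<^sup>2 - 500 * real c \<le> 444000 * (real c)\<^sup>2"
    by (simp add: n_def power2_eq_square algebra_simps)
  moreover have "real c \<le> (real c)\<^sup>2" "1 \<le> real c"
    by (auto simp: c_def power2_eq_square algebra_simps)
  ultimately show False by linarith
qed

section \<open>The split\<close>

text \<open>With \<open>d = y - 2 * x\<close> the ratio condition says \<open>62 * d \<le> x\<close>, whereas the only P-position on this line of
  slope two occurs with a first coordinate at most \<open>61 * d\<close>.\<close>

lemma gdwn_void_sector:
  assumes "(x, y) \<in> gdwn_upper_set"
  shows "\<not> (2 \<le> real y / real x \<and> real y / real x \<le> 2 + 1/62)"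
proof
  assume ratio: "2 \<le> real y / real x \<and> real y / real x \<le> 2 + 1/62"
  have P: "gdwn_P (x, y)" and "0 < x" using assms by (auto simp: gdwn_upper_set_def)
  define d where "d = y - 2 * x"
  have yd: "y = 2 * x + d" and d: "62 * d \<le> x"
    using ratio \<open>0 < x\<close> by (auto simp: d_def field_simps)
  show False
  proof (cases "d = 0")
    case True
    then show False using gdwn_P_steep_unique [OF P gdwn_P_zero] yd \<open>0 < x\<close> by simp
  next
    case False
    then obtain u where u: "u \<le> 61 * d" "(u, 2 * u + d) \<in> gdwn_upper_set"
      using gdwn_steep_line_hit_early by auto
    then have "u = x"
      using gdwn_P_steep_unique [OF P, of u "2 * u + d"] yd by (simp add: gdwn_upper_iff)
    then show False using u d False by simp
  qed
qed

theorem theorem4: "splits gdwn_a gdwn_b"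
proof -
  let ?r = "\<lambda>p :: nat \<times> nat. real (snd p) / real (fst p)"
  have set_eq: "{(gdwn_a i, gdwn_b i) | i. i \<ge> 1 \<and> Q (real (gdwn_b i) / real (gdwn_a i))}
      = {p \<in> gdwn_upper_set. Q (?r p)}" for Q
    unfolding gdwn_ab_range [symmetric] by auto
  have void: "{i. i > n \<and> 2 \<le> real (gdwn_b i) / real (gdwn_a i)
      \<and> real (gdwn_b i) / real (gdwn_a i) \<le> 2 + 1/62} = {}" for n
  proof -
    have "\<not> (2 \<le> real (gdwn_b i) / real (gdwn_a i)
      \<and> real (gdwn_b i) / real (gdwn_a i) \<le> 2 + 1/62)" if "n < i" for i
      using that by (intro gdwn_void_sector gdwn_ab_in_upper_set) simp
    then show ?thesis by blast
  qed
  have "?r p < 2 \<longleftrightarrow> snd p < 2 * fst p" if "p \<in> gdwn_upper_set" for p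
    using gdwn_upperD(3) [OF that] by (simp add: divide_less_eq) linarith
  then have "{p \<in> gdwn_upper_set. ?r p < 2} = {p \<in> gdwn_upper_set. snd p < 2 * fst p}"
    by blast
  then have flat: "infinite {p \<in> gdwn_upper_set. ?r p < 2}"
    using gdwn_infinitely_many_flat by simp
  \<comment> \<open>Every \<open>d > 0\<close> is some \<open>b - 2 * a\<close>, and a pair of ratio at least \<open>2\<close> lies above the void sector.\<close>
  have "{1::nat..} \<subseteq> (\<lambda>p. snd p - 2 * fst p) ` {p \<in> gdwn_upper_set. ?r p > 2 + 1/62}"
  proof
    fix d :: nat assume "d \<in> {1..}"
    then have "0 < d" by simp
    then obtain x where x: "(x, 2 * x + d) \<in> gdwn_upper_set"
      using gdwn_steep_line_hit_early by blast
    then have "0 < x" by (simp add: gdwn_upper_set_def)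
    then have "2 \<le> ?r (x, 2 * x + d)" by (simp add: field_simps)
    then have "?r (x, 2 * x + d) > 2 + 1/62" using gdwn_void_sector [OF x] by auto
    with x show "d \<in> (\<lambda>p. snd p - 2 * fst p) ` {p \<in> gdwn_upper_set. ?r p > 2 + 1/62}"
      by (intro image_eqI [of _ _ "(x, 2 * x + d)"]) auto
  qed
  then have above: "infinite {p \<in> gdwn_upper_set. ?r p > 2 + 1/62}"
    using infinite_Ici [of "1::nat"] finite_surj by blast
  show ?thesis
    unfolding splits_def
  proof (rule exI [of _ 2], rule exI [of _ "1/62"], intro conjI)
    show "infinite {(gdwn_a i, gdwn_b i) | i. i \<ge> 1 \<and> real (gdwn_b i) / real (gdwn_a i) < 2}"
      using flat set_eq [of "\<lambda>r. r < 2"] by simp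
    show "infinite {(gdwn_a i, gdwn_b i) | i. i \<ge> 1 \<and>
        real (gdwn_b i) / real (gdwn_a i) > 2 + 1/62}"
      using above unfolding set_eq [of "\<lambda>r. r > 2 + 1/62"] .
  qed (use void in simp_all)
qed

end
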